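(* Let $t,r$ be positive integers, let $0<\varepsilon\le\frac{1}{(2t)^{t+1}}$, and assume $n$ is large enough. Then there exist functions $f$, defined on all families of at most $(r+1)2^n n^{-(t+0.9)}$ subsets of $[n]$ and taking values in families of at most $(t+1+\varepsilon)\binom{n}{\lfloor n/2\rfloor}$ subsets of $[n]$, and $g$, defined on all families of at most $(r+1)\frac{t+2}{\varepsilon^2 n^t}\binom{n}{\lfloor n/2\rfloor}$ subsets of $[n]$ and taking values in families of at most $(t+\varepsilon)\binom{n}{\lfloor n/2\rfloor}$ subsets of $[n]$, such that for any induced $\vee_{r+1}$-free family $\mathcal F\subseteq 2^{[n]}$ there exist disjoint subfamilies $\mathcal H_1,\mathcal H_2\subseteq\mathcal F$ with $\mathcal H_1$ in the domain of $f$ and $\mathcal H_1\cup\mathcal H_2$ in the domain of $g$, satisfying $(\mathcal H_1\cup\mathcal H_2)\cap g(\mathcal H_1\cup\mathcal H_2)=\emptyset$, $\mathcal H_2\subseteq f(\mathcal H_1)$, and $\mathcal F\subseteq\mathcal H_1\cup\mathcal H_2\cup g(\mathcal H_1\cup\mathcal H_2)$.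
   Context: A family $\mathcal F\subseteq 2^{[n]}$ is induced $\vee_{r+1}$-free if there is no $F\in\mathcal F$ together with $r+1$ pairwise incomparable (under inclusion) sets of $\mathcal F$ each properly containing $F$. *)

theory Defs
  imports Complex_Main "HOL-Library.FuncSet"
begin

definition incomparable :: "'a set \<Rightarrow> 'a set \<Rightarrow> bool" where
  "incomparable A B \<longleftrightarrow> \<not> A \<subseteq> B \<and> \<not> B \<subseteq> A"

definition induced_vee_free :: "nat \<Rightarrow> 'a set set \<Rightarrow> bool" where
  "induced_vee_free k \<F> \<longleftrightarrow>
     \<not> (\<exists>F\<in>\<F>. \<exists>\<G>\<subseteq>\<F>. finite \<G> \<and> card \<G> = k \<and> pairwise incomparable \<G> \<and> (\<forall>G\<in>\<G>. F \<subset> G))"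

text \<open>The families of at most \<open>c\<close> subsets of \<open>{1..n}\<close>; the bound \<open>c\<close> need not be an integer.\<close>

definition families_upto :: "nat \<Rightarrow> real \<Rightarrow> nat set set set" where
  "families_upto n c = {\<H>. \<H> \<subseteq> Pow {1..n} \<and> real (card \<H>) \<le> c}"

end

theory Submission
  imports Defs "HOL-Combinatorics.Multiset_Permutations"
begin

text \<open>
  Container argument. The sets of a family at a fixed distance \<open>j\<close> above a set \<open>F\<close> form an antichain, so
  an induced \<open>\<or>\<close>-free family containing \<open>F\<close> has at most \<open>r\<close> of them. As long as some \<open>F\<close> in the current
  container has at least \<open>D\<close> supersets at some distance \<open>j\<close>, one asks whether \<open>F\<close> is in the given family: if not, \<open>F\<close>
  leaves the container; if so, \<open>F\<close> and the at most \<open>r\<close> members of that level join the fingerprint while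
  the whole level leaves the container. The answers can be read off from the fingerprint alone.
  When the process stops, every level has fewer than \<open>D\<close> sets, and averaging over maximal chains
  shows that for \<open>D\<close> a small multiple of \<open>n ^ k\<close> the container has size at most \<open>k + \<epsilon>\<close>
  times the central binomial coefficient. Running this with \<open>D = n powr (t + 9/10)\<close>, \<open>k = t + 1\<close>,
  and then with \<open>D = \<epsilon>\<^sup>2 * n ^ t\<close>, \<open>k = t\<close>, gives \<open>f\<close> and \<open>g\<close>.
\<close>

section \<open>Levels above a set and the container process\<close>

text \<open>For \<open>j > 0\<close> the difference \<open>G - F\<close> is automatically finite,
  because \<open>card\<close> of an infinite set is 0.\<close>

definition upper_level :: "'a set \<Rightarrow> nat \<Rightarrow> 'a set set \<Rightarrow> 'a set set" where
  "upper_level F j \<A> = {G \<in> \<A>. F \<subset> G \<and> card (G - F) = j}"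

text \<open>Differences from \<open>F\<close> within one level have the same finite size, so
  containment between two members forces equality. Hence \<open>r + 1\<close> members of
  \<open>S\<close> in a level would be pairwise incomparable sets above \<open>F\<close>.\<close>

lemma card_upper_level_vee_free:
  assumes "induced_vee_free (r + 1) S" "F \<in> S" "finite \<A>" "j > 0"
  shows "card (S \<inter> upper_level F j \<A>) \<le> r"
proof (rule ccontr)
  assume "\<not> ?thesis"
  then obtain \<G> where G: "\<G> \<subseteq> S \<inter> upper_level F j \<A>" "card \<G> = r + 1" "finite \<G>"
    by (metis Suc_eq_plus1 not_less_eq_eq obtain_subset_with_card_n)
  have "G = G'" if "G \<in> \<G>" "G' \<in> \<G>" "G \<subseteq> G'" for G G'
  proof -
    have GG: "F \<subset> G" "F \<subset> G'" "card (G - F) = j" "card (G' - F) = j"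
      using that G by (auto simp: upper_level_def)
    moreover have "finite (G' - F)" using GG \<open>j > 0\<close> card_gt_0_iff by metis
    ultimately have "G - F = G' - F"
      using that by (intro card_subset_eq) auto
    with GG show ?thesis by blast
  qed
  then have "pairwise incomparable \<G>"
    unfolding pairwise_def incomparable_def by metis
  moreover have "\<forall>G\<in>\<G>. F \<subset> G" "\<G> \<subseteq> S" using G by (auto simp: upper_level_def)
  ultimately show False
    using assms G unfolding induced_vee_free_def by blast
qed

text \<open>
  Here \<open>h S\<close> is the fingerprint of \<open>S\<close> and \<open>c S\<close> its container. The clause on \<open>S'\<close> says that both
  can be recomputed from any family between the fingerprint and \<open>S\<close>.
\<close>

definition container_maps ::
    "real \<Rightarrow> 'a set set \<Rightarrow> ('a set set \<Rightarrow> 'a set set) \<Rightarrow> ('a set set \<Rightarrow> 'a set set) \<Rightarrow> bool" where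
  "container_maps D \<A> h c \<longleftrightarrow> (\<forall>S. h S \<subseteq> S \<inter> \<A> \<and> c S \<subseteq> \<A> \<and> S \<inter> \<A> \<subseteq> h S \<union> c S \<and> h S \<inter> c S = {} \<and>
     (\<forall>S'. h S \<subseteq> S' \<and> S' \<subseteq> S \<longrightarrow> h S' = h S \<and> c S' = c S) \<and>
     (\<forall>F\<in>c S. \<forall>j>0. real (card (upper_level F j (c S))) < D) \<and>
     (\<forall>r. induced_vee_free (r + 1) S \<longrightarrow> real (card (h S)) * D \<le> (real r + 1) * real (card \<A>)))"

lemma container_mapsD:
  assumes "container_maps D \<A> h c"
  shows "h S \<subseteq> S \<inter> \<A>" "c S \<subseteq> \<A>" "S \<inter> \<A> \<subseteq> h S \<union> c S" "h S \<inter> c S = {}"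
    and "h S \<subseteq> S' \<Longrightarrow> S' \<subseteq> S \<Longrightarrow> h S' = h S"
    and "h S \<subseteq> S' \<Longrightarrow> S' \<subseteq> S \<Longrightarrow> c S' = c S"
    and "F \<in> c S \<Longrightarrow> j > 0 \<Longrightarrow> real (card (upper_level F j (c S))) < D"
    and "induced_vee_free (r + 1) S \<Longrightarrow> real (card (h S)) * D \<le> (real r + 1) * real (card \<A>)"
proof -
  have "h S \<subseteq> S \<inter> \<A>" "c S \<subseteq> \<A>" "S \<inter> \<A> \<subseteq> h S \<union> c S" "h S \<inter> c S = {}"
    and stable: "\<forall>S'. h S \<subseteq> S' \<and> S' \<subseteq> S \<longrightarrow> h S' = h S \<and> c S' = c S"
    and degree: "\<forall>F\<in>c S. \<forall>j>0. real (card (upper_level F j (c S))) < D"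
    and bound: "\<forall>r. induced_vee_free (r + 1) S \<longrightarrow> real (card (h S)) * D \<le> (real r + 1) * real (card \<A>)"
    using assms[unfolded container_maps_def, THEN spec, of S] by - (elim conjE, assumption)+
  then show "h S \<subseteq> S \<inter> \<A>" "c S \<subseteq> \<A>" "S \<inter> \<A> \<subseteq> h S \<union> c S" "h S \<inter> c S = {}"
    by - assumption+
  show "h S \<subseteq> S' \<Longrightarrow> S' \<subseteq> S \<Longrightarrow> h S' = h S" "h S \<subseteq> S' \<Longrightarrow> S' \<subseteq> S \<Longrightarrow> c S' = c S"
    using stable[THEN spec, of S'] by blast+
  show "F \<in> c S \<Longrightarrow> j > 0 \<Longrightarrow> real (card (upper_level F j (c S))) < D"
    using degree by blast
  show "induced_vee_free (r + 1) S \<Longrightarrow> real (card (h S)) * D \<le> (real r + 1) * real (card \<A>)"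
    using bound by blast
qed

text \<open>Induction on the current container: a set \<open>F\<close> with a level of size at least
  \<open>D\<close> splits the process into two branches, one for each answer to
  \<open>F \<in> S\<close>. A positive answer adds at most \<open>r + 1\<close> sets to the
  fingerprint and removes at least \<open>D\<close> sets from the container, which gives the bound
  on \<open>card (h S) * D\<close>.\<close>

lemma container_maps_exist:
  assumes "finite \<A>" "D \<ge> 0"
  shows "\<exists>h c. container_maps D \<A> h c"
  using assms(1)
proof (induction \<A> rule: finite_psubset_induct)
  case (psubset \<A>)
  show ?case
  proof (cases "\<forall>F\<in>\<A>. \<forall>j>0. real (card (upper_level F j \<A>)) < D")
    case True
    then have "container_maps D \<A> (\<lambda>_. {}) (\<lambda>_. \<A>)"
      unfolding container_maps_def by simp
    then show ?thesis by blast
  next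
    case False
    then obtain F j where F: "F \<in> \<A>" "j > 0" "real (card (upper_level F j \<A>)) \<ge> D"
      by (auto simp: not_less)
    define L where "L = upper_level F j \<A>"
    have L: "L \<subseteq> \<A>" "F \<notin> L" by (auto simp: L_def upper_level_def)
    have "\<A> - {F} \<subset> \<A>" "\<A> - insert F L \<subset> \<A>" using F by auto
    from psubset.IH[OF this(1)] psubset.IH[OF this(2)]
    obtain h0 c0 h1 c1 where maps: "container_maps D (\<A> - {F}) h0 c0"
        "container_maps D (\<A> - insert F L) h1 c1"
      by blast
    note 0 = container_mapsD[OF maps(1)] and 1 = container_mapsD[OF maps(2)]
    define h where "h = (\<lambda>S. if F \<in> S then insert F (S \<inter> L) \<union> h1 S else h0 S)"
    define c where "c = (\<lambda>S. if F \<in> S then c1 S else c0 S)"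
    have fin: "finite \<A>" "finite L" using psubset.hyps finite_subset[OF L(1)] by auto
    have sub: "h S \<subseteq> S \<inter> \<A>" for S
      using 0(1)[of S] 1(1)[of S] F L unfolding h_def by auto
    have sub': "c S \<subseteq> \<A>" for S
      using 0(2)[of S] 1(2)[of S] unfolding c_def by auto
    have cover: "S \<inter> \<A> \<subseteq> h S \<union> c S" for S
      using 0(3)[of S] 1(3)[of S] unfolding h_def c_def by auto
    have disjoint: "h S \<inter> c S = {}" for S
      using 0(4)[of S] 1(2,4)[of S] unfolding h_def c_def by auto
    \<comment> \<open>If \<open>F \<in> S\<close>, then \<open>F\<close> and all of
      \<open>S \<inter> L\<close> lie in \<open>h S\<close>, hence in \<open>S'\<close>, so
      \<open>S'\<close> takes the same branch and records the same part of \<open>L\<close>. If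
      \<open>F \<notin> S\<close>, then \<open>F \<notin> S'\<close> because
      \<open>S' \<subseteq> S\<close>. The rest is stability of the branch.\<close>
    have stable: "h S' = h S \<and> c S' = c S" if "h S \<subseteq> S' \<and> S' \<subseteq> S" for S S'
    proof (cases "F \<in> S")
      case True
      then have sub: "insert F (S \<inter> L) \<subseteq> S'" "h1 S \<subseteq> S'" using that by (simp_all add: h_def)
      moreover have "S' \<inter> L = S \<inter> L" using sub that by auto
      ultimately show ?thesis
        using True that 1(5,6)[OF sub(2)] by (simp add: h_def c_def)
    next
      case False
      then have "h0 S \<subseteq> S'" using that by (simp add: h_def)
      moreover have "F \<notin> S'" using False that by auto
      ultimately show ?thesis using False that 0(5,6)[of S S'] by (simp add: h_def c_def)
    qed
    have degree: "real (card (upper_level G j (c S))) < D" if "G \<in> c S" "j > 0" for G j S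
      using 0(7)[of G S j] 1(7)[of G S j] that unfolding c_def by (simp split: if_splits)
    have bound: "real (card (h S)) * D \<le> (real r + 1) * real (card \<A>)" if free: "induced_vee_free (r + 1) S" for r S
    proof (cases "F \<in> S")
      case True
      have "card (h S) \<le> card (insert F (S \<inter> L)) + card (h1 S)"
        unfolding h_def using True by (simp add: card_Un_le del: Un_insert_left)
      also have "card (insert F (S \<inter> L)) \<le> r + 1"
        using card_upper_level_vee_free[OF free True psubset.hyps \<open>j > 0\<close>] fin
        by (simp add: L_def card_insert_if)
      finally have h: "real (card (h S)) \<le> real r + 1 + card (h1 S)" by linarith
      \<comment> \<open>Removing \<open>L\<close>, which has at least \<open>D\<close> members by
        the choice of \<open>F\<close> and \<open>j\<close>, pays for the \<open>r + 1\<close> new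
        fingerprint sets.\<close>
      have "card (\<A> - insert F L) + card L = card ((\<A> - insert F L) \<union> L)"
        using fin by (intro card_Un_disjoint[symmetric]) auto
      also have "\<dots> \<le> card \<A>" using fin L by (intro card_mono) auto
      finally have "card (\<A> - insert F L) + card L \<le> card \<A>" .
      then have *: "real (card (\<A> - insert F L)) \<le> card \<A> - D"
        using F unfolding L_def by linarith
      show ?thesis
      proof -
        have "real (card (h S)) * D \<le> (real r + 1) * D + real (card (h1 S)) * D"
          using mult_right_mono[OF h \<open>D \<ge> 0\<close>] by (simp add: algebra_simps)
        also have "real (card (h1 S)) * D \<le> (real r + 1) * real (card (\<A> - insert F L))"
          using 1(8)[OF free] .
        also have "\<dots> \<le> (real r + 1) * (card \<A> - D)" using * by (intro mult_left_mono) auto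
        finally show ?thesis by (simp add: algebra_simps)
      qed
    next
      case False
      then have "real (card (h S)) * D \<le> (real r + 1) * real (card (\<A> - {F}))" using 0(8)[OF free] by (simp add: h_def)
      also have "\<dots> \<le> (real r + 1) * real (card \<A>)"
        using fin by (intro mult_left_mono) (auto intro: card_mono)
      finally show ?thesis .
    qed
    have "container_maps D \<A> h c"
      unfolding container_maps_def
      by (intro allI conjI impI ballI sub sub' cover disjoint degree bound
          stable[THEN conjunct1] stable[THEN conjunct2]) blast+
    then show ?thesis by blast
  qed
qed

section \<open>Counting pairs on maximal chains\<close>

text \<open>A permutation stands for the maximal chain formed by the sets of its prefixes. Passing
  through \<open>F\<close> and \<open>G\<close> means being a concatenation of orderings of
  \<open>F\<close>, \<open>G - F\<close> and \<open>S - G\<close>, and the fixed block lengths make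
  this splitting unique. The case \<open>F = G\<close> counts the chains through one set.\<close>

lemma card_permutations_through:
  assumes "finite S" "F \<subseteq> G" "G \<subseteq> S"
  shows "card {xs \<in> permutations_of_set S. set (take (card F) xs) = F \<and> set (take (card G) xs) = G}
     = fact (card F) * fact (card (G - F)) * fact (card (S - G))"
proof -
  let ?P = permutations_of_set
  have fin: "finite F" "finite G" "finite (G - F)" "finite (S - G)"
    using assms by (auto intro: finite_subset)
  have "{xs \<in> ?P S. set (take (card F) xs) = F \<and> set (take (card G) xs) = G}
      = (\<lambda>(u, v, w). u @ v @ w) ` (?P F \<times> ?P (G - F) \<times> ?P (S - G))" (is "?L = ?R")
  proof (intro equalityI subsetI)
    fix xs assume "xs \<in> ?L"
    then have xs: "set xs = S" "distinct xs" "set (take (card F) xs) = F" "set (take (card G) xs) = G"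
      by (auto simp: permutations_of_set_def)
    define u v w where "u = take (card F) xs" and "v = drop (card F) (take (card G) xs)"
      and "w = drop (card G) xs"
    have le: "card F \<le> card G" using assms fin by (simp add: card_mono)
    have uv: "take (card G) xs = u @ v"
      unfolding u_def v_def using le by (metis append_take_drop_id min.absorb1 take_take)
    then have "xs = (u @ v) @ w" unfolding w_def by (metis append_take_drop_id)
    then have xs': "xs = u @ v @ w" by simp
    have "set u = F" using xs(3) u_def by simp
    moreover have "set u \<union> set v = G" using xs(4) unfolding uv by simp
    ultimately have "u \<in> ?P F" "v \<in> ?P (G - F)" "w \<in> ?P (S - G)"
      using xs(1,2) xs' by (auto simp: permutations_of_set_def)
    then show "xs \<in> ?R" using xs' by force
  next
    fix xs assume "xs \<in> ?R"
    then obtain u v w where *: "xs = u @ v @ w" "u \<in> ?P F" "v \<in> ?P (G - F)" "w \<in> ?P (S - G)"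
      by auto
    then have "length u = card F" "length v = card (G - F)"
      by (simp_all add: length_finite_permutations_of_set)
    moreover have "card F + card (G - F) = card G"
      using assms fin by (simp add: card_Diff_subset card_mono)
    ultimately show "xs \<in> ?L" using * assms
      by (auto simp: permutations_of_set_def)
  qed
  moreover have "inj_on (\<lambda>(u, v, w). u @ v @ w) (?P F \<times> ?P (G - F) \<times> ?P (S - G))"
    by (rule inj_onI) (auto simp: length_finite_permutations_of_set dest!: append_eq_append_conv[THEN iffD1, rotated])
  ultimately show ?thesis
    using fin by (simp add: card_image card_cartesian_product)
qed

text \<open>At most \<open>k\<close> elements lie in the window of length \<open>k\<close> starting
  at the minimum; every other element forms a pair with the minimum.\<close>

lemma card_le_gap_pairs:
  fixes I :: "nat set"
  assumes "finite I"
  shows "card I \<le> k + card {(i, j) \<in> I \<times> I. i + k \<le> j}"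
proof (cases "I = {}")
  case False
  define m where "m = Min I"
  have m: "m \<in> I" "\<And>i. i \<in> I \<Longrightarrow> m \<le> i" using assms False by (auto simp: m_def)
  have "I \<subseteq> {m..<m + k} \<union> {i \<in> I. m + k \<le> i}" using m by auto
  then have "card I \<le> card ({m..<m + k} \<union> {i \<in> I. m + k \<le> i})"
    using assms by (intro card_mono) auto
  also have "\<dots> \<le> k + card {i \<in> I. m + k \<le> i}" using card_Un_le[of "{m..<m + k}"] by simp
  also have "card {i \<in> I. m + k \<le> i} = card (Pair m ` {i \<in> I. m + k \<le> i})"
    by (simp add: card_image inj_on_def)
  also have "\<dots> \<le> card {(i, j) \<in> I \<times> I. i + k \<le> j}"
  proof (rule card_mono)
    show "finite {(i, j) \<in> I \<times> I. i + k \<le> j}"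
      by (rule finite_subset[of _ "I \<times> I"]) (use assms in auto)
    show "Pair m ` {i \<in> I. m + k \<le> i} \<subseteq> {(i, j) \<in> I \<times> I. i + k \<le> j}"
      using m(1) by auto
  qed
  finally show ?thesis by simp
qed simp

text \<open>Members of a chain are determined by their cardinalities and nested in that order, so
  gaps between sizes are distances between sets and the bound for sets of numbers carries
  over.\<close>

lemma chain_gap_pairs:
  assumes "finite \<A>" "distinct xs" "k > 0"
    and \<A>: "\<And>F. F \<in> \<A> \<Longrightarrow> F \<subseteq> set xs"
  shows "card {F \<in> \<A>. set (take (card F) xs) = F} \<le> k +
    card {(F, G) \<in> \<A> \<times> \<A>. (F \<subset> G \<and> k \<le> card (G - F)) \<and>
      set (take (card F) xs) = F \<and> set (take (card G) xs) = G}"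
    (is "card ?B \<le> k + card ?C")
proof -
  define I where "I = card ` ?B"
  have inj: "inj_on card ?B" 
  proof (rule inj_onI)
    fix F G assume "F \<in> ?B" "G \<in> ?B" "card F = card G"
    then have "set (take (card F) xs) = F" "set (take (card F) xs) = G" by simp_all
    then show "F = G" by simp
  qed
  have B: "finite ?B" using assms by simp
  have C: "finite ?C" by (rule finite_subset[of _ "\<A> \<times> \<A>"]) (use assms in auto)
  have "card ?B = card I" unfolding I_def using inj by (simp add: card_image)
  also have "\<dots> \<le> k + card {(i, j) \<in> I \<times> I. i + k \<le> j}"
    by (rule card_le_gap_pairs) (use B in \<open>simp add: I_def\<close>)
  also have "card {(i, j) \<in> I \<times> I. i + k \<le> j} \<le> card ((\<lambda>(F, G). (card F, card G)) ` ?C)"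
  proof (rule card_mono)
    show "finite ((\<lambda>(F, G). (card F, card G)) ` ?C)" using C by simp
    show "{(i, j) \<in> I \<times> I. i + k \<le> j} \<subseteq> (\<lambda>(F, G). (card F, card G)) ` ?C"
    proof clarify
      fix i j assume "i \<in> I" "j \<in> I" and ij: "i + k \<le> j"
      then obtain F G where FG: "F \<in> ?B" "G \<in> ?B" "i = card F" "j = card G"
        unfolding I_def by blast
      have "set (take (card F) xs) \<subseteq> set (take (card G) xs)"
        by (rule set_take_subset_set_take) (use ij FG(3,4) in linarith)
      then have sub: "F \<subseteq> G" using FG(1,2) by simp
      have fin: "finite F" using \<A>[of F] FG(1) by (auto intro: finite_subset)
      have "k \<le> card (G - F)" using ij FG(3,4) fin sub by (simp add: card_Diff_subset)
      moreover have "F \<noteq> G" using ij FG(3,4) \<open>k > 0\<close> by auto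
      ultimately have "(F, G) \<in> ?C" using FG(1,2) sub by simp
      then show "(i, j) \<in> (\<lambda>(F, G). (card F, card G)) ` ?C"
        unfolding FG(3,4) by (rule rev_image_eqI) simp
    qed
  qed
  also have "\<dots> \<le> card ?C" using C by (rule card_image_le)
  finally show ?thesis by simp
qed

lemma sum_card_swap:
  assumes "finite A" "finite B"
  shows "(\<Sum>x\<in>A. card {y \<in> B. R x y}) = (\<Sum>y\<in>B. card {x \<in> A. R x y})"
proof -
  have "card {y \<in> B. R x y} = (\<Sum>y\<in>B. of_bool (R x y))" for x
    using assms by (simp add: sum_of_bool_eq Int_def)
  moreover have "card {x \<in> A. R x y} = (\<Sum>x\<in>A. of_bool (R x y))" for y
    using assms by (simp add: sum_of_bool_eq Int_def)
  ultimately show ?thesis using sum.swap by simp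
qed

text \<open>If \<open>j\<close> is beyond the middle, its mirror image \<open>m - j\<close> is not,
  and \<open>i + j \<le> m\<close> keeps \<open>i\<close> below that image. This form serves levels
  that may lie beyond the middle.\<close>

lemma binomial_mono_between:
  fixes i j m :: nat
  assumes "i \<le> j" "i + j \<le> m"
  shows "m choose i \<le> m choose j"
proof (cases "2 * j \<le> m")
  case False
  then have "m choose i \<le> m choose (m - j)" using assms by (intro binomial_mono) auto
  then show ?thesis using assms binomial_symmetric[of j m] by simp
qed (use assms in \<open>simp add: binomial_mono\<close>)

text \<open>Let X be the number of members of \<open>\<A>\<close> on a uniformly random maximal
  chain. A chain through \<open>F\<close> passes through \<open>G\<close> with probability
  \<open>1 / (n - card F choose card (G - F))\<close>, so the expected number of pairs at distance
  at least \<open>k\<close> is at most \<beta> E X. Since X - k is at most the number of such pairs,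
  (1 - \<beta>) E X \<le> k, while E X is at least \<open>card \<A>\<close> divided by the central
  binomial coefficient. The terms of \<beta> cover level \<open>k\<close>, level
  \<open>k + 1\<close> and all higher levels. When \<open>D\<close> has order n^k, the lower index
  \<open>k + 2\<close> compensates for the factor \<open>card S\<close>.\<close>

lemma supersaturation:
  fixes \<A> :: "'a set set" and D \<beta> :: real
  assumes "finite S" "\<A> \<subseteq> Pow S" "0 < k" "k + 2 \<le> a" "0 \<le> D"
    and size: "\<And>F. F \<in> \<A> \<Longrightarrow> card F + a \<le> card S"
    and degree: "\<And>F j. F \<in> \<A> \<Longrightarrow> j > 0 \<Longrightarrow> real (card (upper_level F j \<A>)) \<le> D"
    and \<beta>: "D / real (a choose k) + D / real (a choose (k + 1))
          + real (card S) * D / real (a choose (k + 2)) \<le> \<beta>" "\<beta> \<le> 1"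
  shows "(1 - \<beta>) * real (card \<A>) \<le> real k * real (card S choose (card S div 2))"
proof -
  define n where "n = card S"
  define P where "P = permutations_of_set S"
  define on where "on = (\<lambda>F (xs :: 'a list). set (take (card F) xs) = F)"
  define U where "U = (\<lambda>F. {G \<in> \<A>. F \<subset> G \<and> k \<le> card (G - F)})"
  define p where "p = (\<lambda>F. real (card {xs \<in> P. on F xs}))"
  have fin: "finite \<A>" "finite P" and finU: "\<And>F. finite (U F)"
    using assms finite_subset[of \<A> "Pow S"] by (auto simp: P_def U_def)
  have sub: "F \<subseteq> S" "finite F" "card F \<le> n" if "F \<in> \<A>" for F
    using assms that by (auto simp: n_def intro: finite_subset card_mono)
  have p: "p F = fact n / real (n choose card F)" if "F \<in> \<A>" for F
    using card_permutations_through[of S F F] sub[OF that] \<open>finite S\<close>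
    by (simp add: p_def P_def on_def n_def card_Diff_subset binomial_fact)
  have p2: "real (card {xs \<in> P. on F xs \<and> on G xs}) = p F / real ((n - card F) choose card (G - F))"
    if "F \<in> \<A>" "G \<in> U F" for F G
  proof -
    have G: "G \<in> \<A>" "F \<subseteq> G" using that by (auto simp: U_def)
    have "card F \<le> card G" using G sub by (simp add: card_mono)
    then show ?thesis
      unfolding p[OF that(1)]
      using card_permutations_through[of S F G] sub[OF G(1)] sub[OF that(1)] \<open>finite S\<close> G
      by (simp add: P_def on_def n_def card_Diff_subset binomial_fact)
  qed
  \<comment> \<open>\<open>v j\<close> caps the contribution of level \<open>j\<close> to the
    conditional expectation.\<close>
  define v where "v = (\<lambda>j. if j = k then D / real (a choose k) else
      if j = k + 1 then D / real (a choose (k + 1)) else D / real (a choose (k + 2)))"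
  have degree_sum: "(\<Sum>G\<in>U F. 1 / real ((n - card F) choose card (G - F))) \<le> \<beta>" if F: "F \<in> \<A>" for F
  proof -
    \<comment> \<open>By \<open>size\<close>, every \<open>G\<close> above \<open>F\<close> still
      has at least \<open>a\<close> elements outside it, which limits its distance from
      \<open>F\<close>.\<close>
    define T where "T = {k..n - a - card F}"
    let ?m = "n - card F"
    have T: "(\<lambda>G. card (G - F)) ` U F \<subseteq> T"
    proof
      fix j assume "j \<in> (\<lambda>G. card (G - F)) ` U F"
      then obtain G where G: "G \<in> \<A>" "F \<subset> G" "k \<le> card (G - F)" "j = card (G - F)"
        unfolding U_def by blast
      then have "card (G - F) = card G - card F" using sub[OF F] by (simp add: card_Diff_subset less_imp_le)
      then show "j \<in> T" using G size[OF G(1)] by (simp add: T_def n_def)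
    qed
    have "(\<Sum>G\<in>U F. 1 / real (?m choose card (G - F)))
        = (\<Sum>j\<in>T. \<Sum>G | G \<in> U F \<and> card (G - F) = j. 1 / real (?m choose card (G - F)))"
      using finU T by (intro sum.group[symmetric]) (auto simp: T_def)
    also have "\<dots> = (\<Sum>j\<in>T. real (card (upper_level F j \<A>)) * (1 / real (?m choose j)))"
    proof (intro sum.cong refl)
      fix j assume "j \<in> T"
      then have *: "{G \<in> U F. card (G - F) = j} = upper_level F j \<A>"
        by (auto simp: U_def upper_level_def T_def)
      have "(\<Sum>G | G \<in> U F \<and> card (G - F) = j. 1 / real (?m choose card (G - F)))
          = (\<Sum>G | G \<in> U F \<and> card (G - F) = j. 1 / real (?m choose j))"
        by (intro sum.cong) auto
      then show "(\<Sum>G | G \<in> U F \<and> card (G - F) = j. 1 / real (?m choose card (G - F)))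
          = real (card (upper_level F j \<A>)) * (1 / real (?m choose j))"
        unfolding * by simp
    qed
    also have "\<dots> \<le> (\<Sum>j\<in>T. v j)"
    proof (intro sum_mono)
      fix j assume j: "j \<in> T"
      then have le: "k \<le> j" "a + j \<le> ?m" using size[OF F] \<open>0 < k\<close> unfolding T_def n_def by auto
      \<comment> \<open>Truncating the level at \<open>k + 2\<close> keeps \<open>i \<le> a\<close>.
        Then \<open>i + j \<le> a + j \<le> n - card F\<close>, as the comparison of binomial
        coefficients requires.\<close>
      define i where "i = (if j \<le> k + 1 then j else k + 2)"
      have i: "i \<le> j" "i \<le> a" "v j = D / real (a choose i)"
        using le assms(4) by (auto simp: i_def v_def)
      have "a choose i \<le> ?m choose i" using le by (intro binomial_right_mono) auto
      also have "\<dots> \<le> ?m choose j" using i le by (intro binomial_mono_between) auto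
      finally have "real (a choose i) \<le> real (?m choose j)" by simp
      moreover have "0 < a choose i" using i by simp
      ultimately have "1 / real (?m choose j) \<le> 1 / real (a choose i)"
        by (intro frac_le) auto
      moreover have "real (card (upper_level F j \<A>)) \<le> D" using degree F le \<open>0 < k\<close> by simp
      ultimately have "real (card (upper_level F j \<A>)) * (1 / real (?m choose j)) \<le> D * (1 / real (a choose i))"
        using \<open>0 \<le> D\<close> by (intro mult_mono) auto
      then show "real (card (upper_level F j \<A>)) * (1 / real (?m choose j)) \<le> v j"
        unfolding i(3) by simp
    qed
    \<comment> \<open>The range is stretched so that exactly \<open>n\<close> levels lie beyond
      \<open>k + 1\<close>, giving the factor \<open>card S\<close> in the third term.\<close>
    also have "\<dots> \<le> (\<Sum>j\<in>{k..<Suc (Suc (k + n))}. v j)"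
      using \<open>0 \<le> D\<close> by (intro sum_mono2) (auto simp: T_def v_def)
    also have "\<dots> = v k + (v (k + 1) + (\<Sum>j\<in>{Suc (Suc k)..<Suc (Suc (k + n))}. v j))"
      by (simp add: sum.atLeast_Suc_lessThan del: sum.op_ivl_Suc)
    also have "(\<Sum>j\<in>{Suc (Suc k)..<Suc (Suc (k + n))}. v j) = (\<Sum>j\<in>{Suc (Suc k)..<Suc (Suc (k + n))}. D / real (a choose (k + 2)))"
      by (intro sum.cong) (auto simp: v_def)
    also have "v k + (v (k + 1) + \<dots>) \<le> \<beta>" using \<beta>(1) by (simp add: v_def n_def)
    finally show ?thesis .
  qed
  \<comment> \<open>A chain meeting \<open>\<A>\<close> in \<open>X\<close> sets contains at least \<open>X - k\<close> pairs of sizes \<open>k\<close> or more apart;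
    sum this over all maximal chains, which are the permutations of \<open>S\<close>.\<close>
  have "(\<Sum>F\<in>\<A>. p F) = real (\<Sum>F\<in>\<A>. card {xs \<in> P. on F xs})"
    by (simp add: p_def)
  also have "\<dots> = (\<Sum>xs\<in>P. real (card {F \<in> \<A>. on F xs}))"
    using sum_card_swap[OF fin, of on] by simp
  also have "\<dots> \<le> (\<Sum>xs\<in>P. real k + real (card {(F, G) \<in> \<A> \<times> \<A>. (F \<subset> G \<and> k \<le> card (G - F)) \<and> on F xs \<and> on G xs}))"
  proof (intro sum_mono)
    fix xs assume "xs \<in> P"
    then have "distinct xs" "set xs = S" by (auto simp: P_def permutations_of_set_def)
    then show "real (card {F \<in> \<A>. on F xs}) \<le> real k + real (card {(F, G) \<in> \<A> \<times> \<A>. (F \<subset> G \<and> k \<le> card (G - F)) \<and> on F xs \<and> on G xs})"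
      using chain_gap_pairs[of \<A> xs k] fin sub \<open>0 < k\<close> unfolding on_def
      by (metis (no_types, lifting) of_nat_add of_nat_mono)
  qed
  also have "\<dots> = real k * fact n + real (\<Sum>xs\<in>P. card {q \<in> Sigma \<A> U. on (fst q) xs \<and> on (snd q) xs})"
  proof -
    have "{(F, G) \<in> \<A> \<times> \<A>. (F \<subset> G \<and> k \<le> card (G - F)) \<and> on F xs \<and> on G xs}
       = {q \<in> Sigma \<A> U. on (fst q) xs \<and> on (snd q) xs}" for xs
      by (auto simp: U_def)
    moreover have "real (card P) = fact n" using \<open>finite S\<close> by (simp add: P_def n_def)
    ultimately show ?thesis by (simp add: sum.distrib)
  qed
  also have "(\<Sum>xs\<in>P. card {q \<in> Sigma \<A> U. on (fst q) xs \<and> on (snd q) xs})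
      = (\<Sum>q\<in>Sigma \<A> U. card {xs \<in> P. on (fst q) xs \<and> on (snd q) xs})"
    using fin finU by (intro sum_card_swap) auto
  also have "\<dots> = (\<Sum>F\<in>\<A>. \<Sum>G\<in>U F. card {xs \<in> P. on F xs \<and> on G xs})"
    using fin finU by (subst sum.Sigma) (auto simp: case_prod_beta)
  also have "real \<dots> = (\<Sum>F\<in>\<A>. p F * (\<Sum>G\<in>U F. 1 / real ((n - card F) choose card (G - F))))"
    using p2 by (simp add: sum_distrib_left)
  also have "\<dots> \<le> (\<Sum>F\<in>\<A>. p F * \<beta>)"
    using degree_sum by (intro sum_mono mult_left_mono) (auto simp: p_def)
  also have "\<dots> = \<beta> * (\<Sum>F\<in>\<A>. p F)" by (simp add: sum_distrib_left mult.commute)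
  finally have main: "(1 - \<beta>) * (\<Sum>F\<in>\<A>. p F) \<le> real k * fact n" by (simp add: algebra_simps)
  define C where "C = real (n choose (n div 2))"
  have C: "C > 0" by (simp add: C_def)
  \<comment> \<open>The LYM estimate: the central binomial coefficient is the largest, so every set
    lies on at least \<open>fact n / C\<close> maximal chains.\<close>
  have "real (card \<A>) * (fact n / C) = (\<Sum>F\<in>\<A>. fact n / C)" by simp
  also have "\<dots> \<le> (\<Sum>F\<in>\<A>. p F)"
  proof (intro sum_mono)
    fix F assume "F \<in> \<A>"
    then show "fact n / C \<le> p F"
      unfolding p[OF \<open>F \<in> \<A>\<close>] C_def using sub binomial_maximum[of n "card F"]
      by (intro divide_left_mono) auto
  qed
  finally have "(1 - \<beta>) * (real (card \<A>) * (fact n / C)) \<le> (1 - \<beta>) * (\<Sum>F\<in>\<A>. p F)"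
    using \<beta>(2) by (intro mult_left_mono) auto
  with main have "(1 - \<beta>) * real (card \<A>) * (fact n / C) \<le> real k * C * (fact n / C)"
    using C by simp
  then have "(1 - \<beta>) * real (card \<A>) \<le> real k * C"
    by (rule mult_right_le_imp_le) (use C in simp)
  then show ?thesis by (simp add: C_def n_def)
qed

section \<open>Large sets and the central binomial coefficient\<close>

text \<open>This is the variance n/4 of the size of a random subset. A new element shifts each
  deviation d to d - 1/2 and d + 1/2, whose squares add up to 2 d^2 + 1/2.\<close>

lemma sum_sq_card_deviation:
  "finite S \<Longrightarrow> (\<Sum>F\<in>Pow S. (real (card F) - real (card S) / 2)\<^sup>2) = real (card S) * 2 ^ card S / 4"
proof (induction S rule: finite_induct)
  case (insert x S)
  have fin: "\<And>F. F \<in> Pow S \<Longrightarrow> finite F \<and> x \<notin> F" using insert finite_subset by auto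
  have inj: "inj_on (insert x) (Pow S)" using insert by (auto simp: inj_on_def)
  have "(\<Sum>F\<in>Pow (insert x S). (real (card F) - real (card (insert x S)) / 2)\<^sup>2)
     = (\<Sum>F\<in>Pow S. (real (card F) - (real (card S) + 1) / 2)\<^sup>2) + (\<Sum>F\<in>Pow S. (real (card F) + 1 - (real (card S) + 1) / 2)\<^sup>2)"
    unfolding Pow_insert using insert fin inj
    by (subst sum.union_disjoint) (auto simp: sum.reindex add.commute intro!: sum.cong)
  also have "\<dots> = (\<Sum>F\<in>Pow S. 2 * (real (card F) - real (card S) / 2)\<^sup>2 + 1 / 2)"
    unfolding sum.distrib[symmetric] by (intro sum.cong) (auto simp: power2_eq_square field_simps)
  also have "\<dots> = 2 * (real (card S) * 2 ^ card S / 4) + 2 ^ card S / 2"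
    using insert by (simp add: sum.distrib card_Pow flip: sum_distrib_left)
  finally show ?case using insert by (simp add: field_simps)
qed simp

text \<open>Chebyshev's inequality for the size of a random subset.\<close>

lemma card_large_sets_le:
  fixes x :: real
  assumes "finite S" "x > 0"
  shows "card {F \<in> Pow S. card F \<ge> card S / 2 + x} \<le> real (card S) * 2 ^ card S / (4 * x\<^sup>2)"
proof -
  let ?T = "{F \<in> Pow S. card F \<ge> card S / 2 + x}"
  have "card ?T * x\<^sup>2 = (\<Sum>F\<in>?T. x\<^sup>2)" by simp
  also have "\<dots> \<le> (\<Sum>F\<in>?T. (real (card F) - real (card S) / 2)\<^sup>2)"
    using assms by (intro sum_mono power_mono) auto
  also have "\<dots> \<le> (\<Sum>F\<in>Pow S. (real (card F) - real (card S) / 2)\<^sup>2)"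
    using assms by (intro sum_mono2) auto
  finally show ?thesis using assms sum_sq_card_deviation[of S] by (simp add: field_simps)
qed

text \<open>For even \<open>n = 2 * m\<close> with \<open>m > 0\<close>, induction gives the
  stronger factor \<open>4 * m\<close>: consecutive central coefficients have ratio 2(2m+1)/(m+1),
  and 4m(m+1) \<le> (2m+1)^2. For odd \<open>n\<close> the coefficient is half of the next even
  one.\<close>

lemma central_binomial_sq_lower: "4 ^ n \<le> 2 * (real n + 1) * (real (n choose (n div 2)))\<^sup>2"
proof -
  have odd: "2 * m + 1 choose m = 2 * m + 1 choose Suc m" for m
    using binomial_symmetric[of m "2 * m + 1"] by simp
  have step: "2 * Suc m choose Suc m = 2 * (2 * m + 1 choose m)" for m
    using odd[of m] by simp
  have absorb: "Suc m * (2 * m + 1 choose m) = (2 * m + 1) * (2 * m choose m)" for m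
    using Suc_times_binomial[of m "2 * m"] odd[of m] by simp
  have even: "16 ^ m \<le> 4 * real m * (real (2 * m choose m))\<^sup>2" if "m > 0" for m :: nat
    using that
  proof (induction m rule: nat_induct_non_zero)
    case (Suc m)
    define b where "b = real (2 * m choose m)"
    define b' where "b' = real (2 * Suc m choose Suc m)"
    have "Suc m * (2 * Suc m choose Suc m) = 2 * (Suc m * (2 * m + 1 choose m))"
      unfolding step by (simp only: mult.assoc mult.left_commute)
    then have "real (Suc m * (2 * Suc m choose Suc m)) = real (2 * ((2 * m + 1) * (2 * m choose m)))"
      unfolding absorb by (simp only:)
    then have r: "(real m + 1) * b' = 2 * (2 * real m + 1) * b"
      unfolding b_def b'_def of_nat_mult by (simp add: algebra_simps)
    have "(16 * 16 ^ m) * (real m + 1) \<le> 16 * (4 * real m * b\<^sup>2) * (real m + 1)"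
      using Suc unfolding b_def by (intro mult_right_mono) auto
    also have "\<dots> \<le> 4 * (2 * (2 * real m + 1) * b)\<^sup>2"
      by (simp add: power2_eq_square algebra_simps)
    also have "\<dots> = (4 * (real m + 1) * b'\<^sup>2) * (real m + 1)"
      unfolding r[symmetric] by (simp add: power2_eq_square)
    finally have "16 * 16 ^ m \<le> 4 * (real m + 1) * b'\<^sup>2"
      by (rule mult_right_le_imp_le) simp
    then show ?case unfolding b'_def by (simp add: algebra_simps)
  qed simp
  consider m where "n = 2 * m" "m > 0" | "n = 0" | m where "n = 2 * m + 1"
    by (metis bot_nat_0.not_eq_extremum evenE mult_0_right oddE)
  then show ?thesis
  proof cases
    case 1
    have "4 ^ n \<le> 2 * real n * (real (n choose (n div 2)))\<^sup>2"
      using even[of m] 1 by (simp add: power_mult)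
    also have "\<dots> \<le> 2 * (real n + 1) * (real (n choose (n div 2)))\<^sup>2"
      by (intro mult_right_mono) auto
    finally show ?thesis .
  next
    case 3
    have "16 ^ Suc m \<le> 4 * real (Suc m) * (real (2 * (2 * m + 1 choose m)))\<^sup>2"
      using even[of "Suc m"] unfolding step by simp
    moreover have "(4::real) ^ n = 16 ^ Suc m / 4" using 3 by (simp add: power_mult)
    moreover have "2 * (real n + 1) * (real (n choose (n div 2)))\<^sup>2
        = 4 * real (Suc m) * (real (2 * (2 * m + 1 choose m)))\<^sup>2 / 4"
      using 3 by (simp add: power2_eq_square)
    ultimately show ?thesis by linarith
  qed simp
qed

lemma central_binomial_lower: "2 ^ n \<le> sqrt (2 * (real n + 1)) * real (n choose (n div 2))"
proof -
  have "(2 ^ n)\<^sup>2 = (4::real) ^ n" by (simp flip: power_mult add: mult.commute[of n] power_mult)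
  then have "2 ^ n \<le> sqrt (2 * (real n + 1) * (real (n choose (n div 2)))\<^sup>2)"
    using central_binomial_sq_lower[of n] by (intro real_le_rsqrt) simp
  then show ?thesis by (simp add: real_sqrt_mult)
qed

section \<open>Asymptotic form of the size bound\<close>

lemma binomial_over_power_tendsto:
  fixes a :: "nat \<Rightarrow> nat"
  assumes "(\<lambda>n. real (a n) / real n) \<longlonglongrightarrow> c"
  shows "(\<lambda>n. real (a n choose i) / real n ^ i) \<longlonglongrightarrow> c ^ i / fact i"
proof -
  have "(\<lambda>n. \<Prod>j=0..<i. (real (a n) / real n - real j / real n) / real (i - j))
      \<longlonglongrightarrow> (\<Prod>j=0..<i. (c - 0) / real (i - j))"
    by (intro tendsto_prod tendsto_divide tendsto_diff assms tendsto_const lim_const_over_n) auto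
  also have "(\<Prod>j=0..<i. (c - 0) / real (i - j)) = c ^ i / fact i"
    by (simp add: prod_dividef fact_prod_rev)
  finally show ?thesis
  proof (rule Lim_transform_eventually)
    show "\<forall>\<^sub>F n in sequentially. (\<Prod>j=0..<i. (real (a n) / real n - real j / real n) / real (i - j))
        = real (a n choose i) / real n ^ i"
      using eventually_gt_at_top[of 0]
    proof eventually_elim
      case (elim n)
      have "(\<Prod>j=0..<i. (real (a n) / real n - real j / real n) / real (i - j))
          = (\<Prod>j=0..<i. ((real (a n) - real j) / real (i - j)) / real n)"
        by (intro prod.cong refl) (simp only: diff_divide_distrib[symmetric] divide_divide_eq_left mult.commute)
      also have "\<dots> = real (a n choose i) / real n ^ i"
        by (simp only: prod_dividef prod_constant card_atLeastLessThan diff_zero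
            binomial_gbinomial gbinomial_altdef_of_nat)
      finally show ?case .
    qed
  qed
qed

text \<open>Relative to \<open>D n / real n ^ k\<close>, the second and third terms each carry an
  extra factor of order 1/n, so only the first survives in the limit.\<close>

lemma inverse_binomial_sum_tendsto:
  fixes a :: "nat \<Rightarrow> nat" and D :: "nat \<Rightarrow> real"
  assumes a: "(\<lambda>n. real (a n) / real n) \<longlonglongrightarrow> c" and "c > 0"
    and D: "(\<lambda>n. D n / real n ^ k) \<longlonglongrightarrow> d"
  shows "(\<lambda>n. D n / real (a n choose k) + D n / real (a n choose (k + 1))
      + real n * D n / real (a n choose (k + 2))) \<longlonglongrightarrow> d * fact k / c ^ k"
proof -
  let ?b = "\<lambda>i n. real (a n choose i) / real n ^ i"
  have nz: "c ^ i / fact i \<noteq> 0" for i using \<open>c > 0\<close> by simp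
  note lims = binomial_over_power_tendsto[OF a]
  have "(\<lambda>n. D n / real n ^ k / ?b k n + D n / real n ^ k * (1 / real n) / ?b (k + 1) n
      + D n / real n ^ k * (1 / real n) / ?b (k + 2) n)
    \<longlonglongrightarrow> d / (c ^ k / fact k) + d * 0 / (c ^ (k + 1) / fact (k + 1)) + d * 0 / (c ^ (k + 2) / fact (k + 2))"
    by (intro tendsto_add tendsto_divide[OF _ lims nz] tendsto_mult D lim_const_over_n)
  then have "(\<lambda>n. D n / real n ^ k / ?b k n + D n / real n ^ k * (1 / real n) / ?b (k + 1) n
      + D n / real n ^ k * (1 / real n) / ?b (k + 2) n) \<longlonglongrightarrow> d * fact k / c ^ k"
    by simp
  then show ?thesis
    by (rule Lim_transform_eventually)
      (use eventually_gt_at_top[of 0] in eventually_elim, simp add: power2_eq_square)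
qed

text \<open>The chain count handles the sets that leave at least about c n elements outside, with c
  just below 1/2; the remaining sets are far above the middle and negligible by Chebyshev. As c
  tends to 1/2, the limiting value of \<beta> tends to \<open>d * fact k * 2 ^ k\<close>, and the
  hypothesis on \<open>d\<close> says exactly that k / (1 - \<beta>) < k + \<epsilon> at this
  value.\<close>

lemma card_le_if_bounded_upper_levels:
  fixes D :: "nat \<Rightarrow> real" and d \<epsilon> :: real
  assumes "0 < k" and D: "\<And>n. 0 \<le> D n" "(\<lambda>n. D n / real n ^ k) \<longlonglongrightarrow> d"
    and d: "d * fact k * 2 ^ k * (real k + \<epsilon>) < \<epsilon>" and "0 < \<epsilon>"
  shows "\<forall>\<^sub>F n in sequentially. \<forall>\<A> \<subseteq> Pow {1..n}.
    (\<forall>F\<in>\<A>. \<forall>j>0. real (card (upper_level F j \<A>)) \<le> D n) \<longrightarrow>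
    real (card \<A>) \<le> (real k + \<epsilon>) * real (n choose (n div 2))"
proof -
  define b where "b = (\<lambda>c :: real. d * fact k / c ^ k)"
  have half: "b (1 / 2) = d * fact k * 2 ^ k" by (simp add: b_def power_divide)
  have "b (1 / 2) * (real k + \<epsilon>) < \<epsilon>" using d unfolding half .
  also have "\<epsilon> \<le> 1 * (real k + \<epsilon>)" by simp
  finally have b1: "b (1 / 2) < 1"
    by (rule mult_right_less_imp_less) (use \<open>0 < \<epsilon>\<close> in simp)
  have "real k < (real k + \<epsilon>) * (1 - b (1 / 2))" using d unfolding half by (simp add: algebra_simps)
  then have b2: "real k / (1 - b (1 / 2)) < real k + \<epsilon>" using b1 by (simp add: divide_less_eq)
  \<comment> \<open>The strict inequalities at 1/2 persist for some c slightly below it, and c < 1/2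
    is what makes the discarded sets rare.\<close>
  have lim_b: "(b \<longlongrightarrow> b (1 / 2)) (at_left (1 / 2))"
    unfolding b_def by (intro tendsto_intros) auto
  have "((\<lambda>c. real k / (1 - b c)) \<longlongrightarrow> real k / (1 - b (1 / 2))) (at_left (1 / 2))"
    using b1 by (intro tendsto_intros lim_b) auto
  then have "\<forall>\<^sub>F c in at_left (1 / 2). real k / (1 - b c) < real k + \<epsilon>"
    using b2 by (rule order_tendstoD)
  moreover have "\<forall>\<^sub>F c in at_left (1 / 2). b c < 1" using order_tendstoD(2)[OF lim_b b1] .
  moreover have "\<forall>\<^sub>F c in at_left (1 / 2). c \<in> {0<..<1 / 2 :: real}"
    by (rule eventually_at_left_real) simp
  ultimately have "\<forall>\<^sub>F c in at_left (1 / 2). real k / (1 - b c) < real k + \<epsilon> \<and> b c < 1 \<and> c \<in> {0<..<1 / 2}"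
    by eventually_elim simp
  then obtain c where c: "real k / (1 - b c) < real k + \<epsilon>" "b c < 1" "0 < c" "c < 1 / 2"
    using eventually_happens'[OF trivial_limit_at_left_real] by force
  define a where "a = (\<lambda>n. nat \<lfloor>c * real n\<rfloor>)"
  have a_bounds: "real (a n) \<le> c * real n" "c * real n - 1 \<le> real (a n)" for n
  proof -
    have "real (a n) = of_int \<lfloor>c * real n\<rfloor>" using c by (simp add: a_def)
    then show "real (a n) \<le> c * real n" "c * real n - 1 \<le> real (a n)" by linarith+
  qed
  have a_lim: "(\<lambda>n. real (a n) / real n) \<longlonglongrightarrow> c"
  proof (rule tendsto_sandwich)
    show "(\<lambda>n. c - 1 / real n) \<longlonglongrightarrow> c"
      using tendsto_diff[OF tendsto_const lim_const_over_n[of 1]] by simp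
    show "\<forall>\<^sub>F n in sequentially. c - 1 / real n \<le> real (a n) / real n"
      using eventually_gt_at_top[of 0]
    proof eventually_elim
      case (elim n)
      have "(c * real n - 1) / real n \<le> real (a n) / real n"
        using a_bounds(2) by (rule divide_right_mono) simp
      then show ?case using elim by (simp add: diff_divide_distrib)
    qed
    show "\<forall>\<^sub>F n in sequentially. real (a n) / real n \<le> c"
      using eventually_gt_at_top[of 0]
    proof eventually_elim
      case (elim n)
      then show ?case using a_bounds(1)[of n] by (simp add: divide_le_eq)
    qed
  qed simp
  define \<beta> where "\<beta> = (\<lambda>n. D n / real (a n choose k) + D n / real (a n choose (k + 1))
      + real n * D n / real (a n choose (k + 2)))"
  have \<beta>_lim: "\<beta> \<longlonglongrightarrow> b c"
    unfolding \<beta>_def b_def by (rule inverse_binomial_sum_tendsto[OF a_lim c(3) D(2)])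
  define \<delta> where "\<delta> = 1 / 2 - c"
  have \<delta>: "\<delta> > 0" using c by (simp add: \<delta>_def)
  define C where "C = (\<lambda>n. real (n choose (n div 2)))"
  have C: "C n > 0" for n by (simp add: C_def)
  \<comment> \<open>The Chebyshev bound for the discarded sets, relative to the central binomial
    coefficient. It has order n^(-1/2), since \<open>2 ^ n / C n\<close> is at most of order
    n^(1/2).\<close>
  define e where "e = (\<lambda>n. real n * 2 ^ n / (4 * (\<delta> * real n)\<^sup>2) / C n)"
  have e_lim: "e \<longlonglongrightarrow> 0"
  proof (rule tendsto_sandwich[where f = "\<lambda>_. 0"])
    have "(\<lambda>n. sqrt (2 * (1 / real n) + 2 * (1 / real n) * (1 / real n)) * (1 / (4 * \<delta>\<^sup>2)))
        \<longlonglongrightarrow> sqrt (2 * 0 + 2 * 0 * 0) * (1 / (4 * \<delta>\<^sup>2))"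
      by (intro tendsto_intros lim_const_over_n)
    then show "(\<lambda>n. sqrt (2 * (1 / real n) + 2 * (1 / real n) * (1 / real n)) * (1 / (4 * \<delta>\<^sup>2))) \<longlonglongrightarrow> 0"
      by simp
    show "\<forall>\<^sub>F n in sequentially. 0 \<le> e n" using C by (simp add: e_def less_imp_le)
    show "\<forall>\<^sub>F n in sequentially. e n \<le> sqrt (2 * (1 / real n) + 2 * (1 / real n) * (1 / real n)) * (1 / (4 * \<delta>\<^sup>2))"
      using eventually_gt_at_top[of 0]
    proof eventually_elim
      case (elim n)
      have "2 * (1 / real n) + 2 * (1 / real n) * (1 / real n) = 2 * (real n + 1) / (real n)\<^sup>2"
        using elim by (simp add: field_simps power2_eq_square)
      then have sqrt: "sqrt (2 * (1 / real n) + 2 * (1 / real n) * (1 / real n)) = sqrt (2 * (real n + 1)) / real n"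
        by (simp add: real_sqrt_divide)
      have "e n = (2 ^ n / C n) / (real n * (4 * \<delta>\<^sup>2))"
        using elim by (simp add: e_def power2_eq_square)
      also have "\<dots> \<le> sqrt (2 * (real n + 1)) / (real n * (4 * \<delta>\<^sup>2))"
        using central_binomial_lower[of n] C[of n]
        by (intro divide_right_mono) (auto simp: C_def divide_le_eq)
      finally show ?case unfolding sqrt by simp
    qed
  qed simp
  have "(\<lambda>n. real k / (1 - \<beta> n) + e n) \<longlonglongrightarrow> real k / (1 - b c) + 0"
    using c by (intro tendsto_intros \<beta>_lim e_lim) auto
  then have "\<forall>\<^sub>F n in sequentially. real k / (1 - \<beta> n) + e n < real k + \<epsilon>"
    using c(1) by (intro order_tendstoD(2)) auto
  moreover have "\<forall>\<^sub>F n in sequentially. \<beta> n < 1" using order_tendstoD(2)[OF \<beta>_lim c(2)] .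
  \<comment> \<open>This threshold yields \<open>k + 2 \<le> a n\<close>: one unit of
    \<open>k + 3\<close> is lost to the floor in \<open>a\<close>.\<close>
  moreover have "\<forall>\<^sub>F n in sequentially. n \<ge> nat \<lceil>(real k + 3) / c\<rceil>" by (rule eventually_ge_at_top)
  moreover have "\<forall>\<^sub>F n in sequentially. n > 0" by (rule eventually_gt_at_top)
  ultimately show ?thesis
  proof eventually_elim
    case (elim n)
    have "(real k + 3) / c \<le> real n" using elim(3) by linarith
    then have "real k + 3 \<le> c * real n" using c by (simp add: field_simps)
    then have ka: "k + 2 \<le> a n" using a_bounds(2)[of n] by linarith
    show ?case
    proof (intro allI impI)
      fix \<A> assume \<A>: "\<A> \<subseteq> Pow {1..n}" and deg: "\<forall>F\<in>\<A>. \<forall>j>0. real (card (upper_level F j \<A>)) \<le> D n"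
      define \<A>1 where "\<A>1 = {F \<in> \<A>. card F + a n \<le> n}"
      have fin: "finite \<A>" using \<A> by (rule finite_subset) simp
      have "(1 - \<beta> n) * real (card \<A>1) \<le> real k * real (card {1..n} choose (card {1..n} div 2))"
      proof (rule supersaturation[where D = "D n" and a = "a n"])
        fix F j assume F: "F \<in> \<A>1" "j > (0::nat)"
        have "card (upper_level F j \<A>1) \<le> card (upper_level F j \<A>)"
          using fin by (intro card_mono) (auto simp: upper_level_def \<A>1_def)
        moreover have "real (card (upper_level F j \<A>)) \<le> D n"
          using deg[rule_format, of F j] F by (simp add: \<A>1_def)
        ultimately show "real (card (upper_level F j \<A>1)) \<le> D n" by linarith
      qed (use \<A> D(1) ka elim(2) \<open>0 < k\<close> in \<open>auto simp: \<A>1_def \<beta>_def\<close>)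
      then have 1: "real (card \<A>1) \<le> real k / (1 - \<beta> n) * C n"
        using elim(2) by (simp add: C_def field_simps)
      have "\<A> - \<A>1 \<subseteq> {F \<in> Pow {1..n}. real (card F) \<ge> real (card {1..n}) / 2 + \<delta> * real n}"
      proof
        fix F assume "F \<in> \<A> - \<A>1"
        then have F: "F \<subseteq> {1..n}" "n < card F + a n" using \<A> by (auto simp: \<A>1_def)
        then have "real n < real (card F) + c * real n" using a_bounds(1)[of n] by linarith
        then show "F \<in> {F \<in> Pow {1..n}. real (card F) \<ge> real (card {1..n}) / 2 + \<delta> * real n}"
          using F by (simp add: \<delta>_def algebra_simps)
      qed
      then have "card (\<A> - \<A>1) \<le> card {F \<in> Pow {1..n}. real (card F) \<ge> real (card {1..n}) / 2 + \<delta> * real n}"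
        by (intro card_mono) auto
      also have "real \<dots> \<le> real (card {1..n}) * 2 ^ card {1..n} / (4 * (\<delta> * real n)\<^sup>2)"
        using \<delta> elim by (intro card_large_sets_le) auto
      also have "\<dots> = e n * C n" using C[of n] by (simp add: e_def)
      finally have 2: "real (card (\<A> - \<A>1)) \<le> e n * C n" by simp
      have "\<A>1 \<union> (\<A> - \<A>1) = \<A>" by (auto simp: \<A>1_def)
      then have "card \<A> = card \<A>1 + card (\<A> - \<A>1)"
        using card_Un_disjoint[of \<A>1 "\<A> - \<A>1"] fin by (simp add: \<A>1_def)
      then have "real (card \<A>) \<le> (real k / (1 - \<beta> n) + e n) * C n"
        using 1 2 by (simp add: algebra_simps)
      also have "\<dots> \<le> (real k + \<epsilon>) * C n" using elim(1) C[of n] by (intro mult_right_mono) auto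
      finally show "real (card \<A>) \<le> (real k + \<epsilon>) * real (n choose (n div 2))" by (simp add: C_def)
    qed
  qed
qed

section \<open>Running the container process in two stages\<close>

theorem theorem2p6:
  fixes t r :: nat and \<epsilon> :: real
  assumes "t > 0" and "r > 0"
    and "0 < \<epsilon>" and "\<epsilon> \<le> 1 / (2 * real t) ^ (t + 1)"
  shows "\<exists>N. \<forall>n\<ge>N. \<exists>f g.
      f \<in> families_upto n ((real r + 1) * 2 ^ n * real n powr - (real t + 9/10))
          \<rightarrow> families_upto n ((real t + 1 + \<epsilon>) * real (n choose (n div 2))) \<and>
      g \<in> families_upto n ((real r + 1) * ((real t + 2) / (\<epsilon>\<^sup>2 * real n ^ t)) * real (n choose (n div 2)))
          \<rightarrow> families_upto n ((real t + \<epsilon>) * real (n choose (n div 2))) \<and>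
      (\<forall>\<F>. \<F> \<subseteq> Pow {1..n} \<and> induced_vee_free (r + 1) \<F> \<longrightarrow>
        (\<exists>\<H>\<^sub>1 \<H>\<^sub>2. \<H>\<^sub>1 \<subseteq> \<F> \<and> \<H>\<^sub>2 \<subseteq> \<F> \<and> \<H>\<^sub>1 \<inter> \<H>\<^sub>2 = {} \<and>
          \<H>\<^sub>1 \<in> families_upto n ((real r + 1) * 2 ^ n * real n powr - (real t + 9/10)) \<and>
          \<H>\<^sub>1 \<union> \<H>\<^sub>2 \<in> families_upto n ((real r + 1) * ((real t + 2) / (\<epsilon>\<^sup>2 * real n ^ t)) * real (n choose (n div 2))) \<and>
          (\<H>\<^sub>1 \<union> \<H>\<^sub>2) \<inter> g (\<H>\<^sub>1 \<union> \<H>\<^sub>2) = {} \<and>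
          \<H>\<^sub>2 \<subseteq> f \<H>\<^sub>1 \<and>
          \<F> \<subseteq> \<H>\<^sub>1 \<union> \<H>\<^sub>2 \<union> g (\<H>\<^sub>1 \<union> \<H>\<^sub>2)))"
proof -
  define C where "C = (\<lambda>n. real (n choose (n div 2)))"
  define D1 where "D1 = (\<lambda>n. real n powr (real t + 9/10))"
  define D2 where "D2 = (\<lambda>n. \<epsilon>\<^sup>2 * real n ^ t)"
  have "(2 * 1) ^ 2 \<le> (2 * real t) ^ (t + 1)"
    using \<open>t > 0\<close> by (intro order.trans[OF power_mono power_increasing]) auto
  then have "1 / (2 * real t) ^ (t + 1) \<le> 1 / 4" by (intro frac_le) auto
  then have \<epsilon>: "\<epsilon> \<le> 1 / 4" using assms(4) by linarith
  have large1: "\<forall>\<^sub>F n in sequentially. \<forall>\<A> \<subseteq> Pow {1..n}.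
      (\<forall>F\<in>\<A>. \<forall>j>0. real (card (upper_level F j \<A>)) \<le> D1 n) \<longrightarrow>
      real (card \<A>) \<le> (real (t + 1) + \<epsilon>) * real (n choose (n div 2))"
  proof (rule card_le_if_bounded_upper_levels)
    \<comment> \<open>Here \<open>D1 n\<close> has smaller order than n^(t+1), so the limit
      \<open>d\<close> is 0 and its condition reduces to \<open>0 < \<epsilon>\<close>.\<close>
    have "(\<lambda>n. real n powr - (1/10)) \<longlonglongrightarrow> 0"
      by (rule tendsto_neg_powr[OF _ filterlim_real_sequentially]) simp
    then show "(\<lambda>n. D1 n / real n ^ (t + 1)) \<longlonglongrightarrow> 0"
    proof (rule Lim_transform_eventually)
      show "\<forall>\<^sub>F n in sequentially. real n powr - (1/10) = D1 n / real n ^ (t + 1)"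
        using eventually_gt_at_top[of 0]
      proof eventually_elim
        case (elim n)
        have "D1 n / real n ^ (t + 1) = real n powr (real t + 9/10) / real n powr real (t + 1)"
          using elim by (simp only: D1_def powr_realpow of_nat_0_less_iff)
        also have "\<dots> = real n powr - (1/10)" by (simp flip: powr_diff)
        finally show ?case by simp
      qed
    qed
  qed (use assms in \<open>auto simp: D1_def\<close>)
  have large2: "\<forall>\<^sub>F n in sequentially. \<forall>\<A> \<subseteq> Pow {1..n}.
      (\<forall>F\<in>\<A>. \<forall>j>0. real (card (upper_level F j \<A>)) \<le> D2 n) \<longrightarrow>
      real (card \<A>) \<le> (real t + \<epsilon>) * real (n choose (n div 2))"
  proof (rule card_le_if_bounded_upper_levels)
    have "(\<lambda>n. \<epsilon>\<^sup>2) \<longlonglongrightarrow> \<epsilon>\<^sup>2" by simp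
    then show "(\<lambda>n. D2 n / real n ^ t) \<longlonglongrightarrow> \<epsilon>\<^sup>2"
      by (rule Lim_transform_eventually)
        (use eventually_gt_at_top[of 0] in eventually_elim, simp add: D2_def)
    \<comment> \<open>The condition for \<open>d = \<epsilon>\<^sup>2\<close> is where the upper
      bound on \<epsilon> enters: together with t! \<le> t^t it leaves (t + \<epsilon>) / (2t),
      which is below 1.\<close>
    have "fact t * 2 ^ t \<le> (2 * real t) ^ t"
      using fact_le_power[of t, where 'a = real] by (simp add: power_mult_distrib)
    then have "\<epsilon> * (fact t * 2 ^ t) * (real t + \<epsilon>) \<le> 1 / (2 * real t) ^ (t + 1) * (2 * real t) ^ t * (real t + \<epsilon>)"
      using assms by (intro mult_mono) auto
    also have "\<dots> = (real t + \<epsilon>) / (2 * real t)" using \<open>t > 0\<close> by simp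
    also have "\<dots> < 1" using \<epsilon> \<open>t > 0\<close> by (simp add: divide_less_eq)
    finally have "\<epsilon> * (\<epsilon> * (fact t * 2 ^ t) * (real t + \<epsilon>)) < \<epsilon> * 1"
      using \<open>0 < \<epsilon>\<close> by (intro mult_strict_left_mono)
    then show "\<epsilon>\<^sup>2 * fact t * 2 ^ t * (real t + \<epsilon>) < \<epsilon>"
      by (simp add: power2_eq_square mult_ac)
  qed (use assms in \<open>auto simp: D2_def\<close>)
  have "(\<lambda>n. real n powr - (4/10)) \<longlonglongrightarrow> 0"
    by (rule tendsto_neg_powr[OF _ filterlim_real_sequentially]) simp
  then have "\<forall>\<^sub>F n in sequentially. real n powr - (4/10) < 1 / 2"
    by (rule order_tendstoD) simp
  with large1 large2 eventually_gt_at_top[of 0]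
  have "\<forall>\<^sub>F n in sequentially. \<exists>f g.
      f \<in> families_upto n ((real r + 1) * 2 ^ n * real n powr - (real t + 9/10))
          \<rightarrow> families_upto n ((real t + 1 + \<epsilon>) * real (n choose (n div 2))) \<and>
      g \<in> families_upto n ((real r + 1) * ((real t + 2) / (\<epsilon>\<^sup>2 * real n ^ t)) * real (n choose (n div 2)))
          \<rightarrow> families_upto n ((real t + \<epsilon>) * real (n choose (n div 2))) \<and>
      (\<forall>\<F>. \<F> \<subseteq> Pow {1..n} \<and> induced_vee_free (r + 1) \<F> \<longrightarrow>
        (\<exists>\<H>\<^sub>1 \<H>\<^sub>2. \<H>\<^sub>1 \<subseteq> \<F> \<and> \<H>\<^sub>2 \<subseteq> \<F> \<and> \<H>\<^sub>1 \<inter> \<H>\<^sub>2 = {} \<and>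
          \<H>\<^sub>1 \<in> families_upto n ((real r + 1) * 2 ^ n * real n powr - (real t + 9/10)) \<and>
          \<H>\<^sub>1 \<union> \<H>\<^sub>2 \<in> families_upto n ((real r + 1) * ((real t + 2) / (\<epsilon>\<^sup>2 * real n ^ t)) * real (n choose (n div 2))) \<and>
          (\<H>\<^sub>1 \<union> \<H>\<^sub>2) \<inter> g (\<H>\<^sub>1 \<union> \<H>\<^sub>2) = {} \<and>
          \<H>\<^sub>2 \<subseteq> f \<H>\<^sub>1 \<and>
          \<F> \<subseteq> \<H>\<^sub>1 \<union> \<H>\<^sub>2 \<union> g (\<H>\<^sub>1 \<union> \<H>\<^sub>2)))"
  proof eventually_elim
    case (elim n)
    have pos: "D1 n > 0" "D2 n > 0" "C n > 0"
      using elim(3) \<open>0 < \<epsilon>\<close> by (auto simp: D1_def D2_def C_def)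
    obtain h1 c1 where cm1: "container_maps (D1 n) (Pow {1..n}) h1 c1"
      using container_maps_exist[of "Pow {1..n}" "D1 n"] pos by auto
    \<comment> \<open>The second stage starts from a container that varies with the argument. Its
      maps are therefore chosen for all starting families at once, so that \<open>g\<close> depends
      on its argument alone.\<close>
    have "\<forall>\<A> :: nat set set. \<exists>h c. finite \<A> \<longrightarrow> container_maps (D2 n) \<A> h c"
      using container_maps_exist pos by (meson less_imp_le)
    then obtain h2 c2 where cm2: "\<And>\<A> :: nat set set. finite \<A> \<Longrightarrow> container_maps (D2 n) \<A> (h2 \<A>) (c2 \<A>)"
      unfolding choice_iff by blast
    note 1 = container_mapsD[OF cm1]
    have fin: "finite (c1 S)" for S using 1(2)[of S] by (rule finite_subset) simp
    note 2 = container_mapsD[OF cm2[OF fin]]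
    define g where "g = (\<lambda>S. c2 (c1 S) S)"
    have c1_le: "real (card (c1 S)) \<le> (real t + 1 + \<epsilon>) * C n" for S
    proof -
      have "\<forall>F\<in>c1 S. \<forall>j>0. real (card (upper_level F j (c1 S))) \<le> D1 n"
        using 1(7) by (blast intro: less_imp_le)
      then show ?thesis using elim(1)[THEN spec, of "c1 S"] 1(2)[of S] by (simp add: C_def add.commute)
    qed
    have g_sub: "g S \<subseteq> Pow {1..n}" for S using 1(2)[of S] 2(2)[of S S] by (auto simp: g_def)
    have g_le: "real (card (g S)) \<le> (real t + \<epsilon>) * C n" for S
    proof -
      have "\<forall>F\<in>g S. \<forall>j>0. real (card (upper_level F j (g S))) \<le> D2 n"
        unfolding g_def using 2(7) by (blast intro: less_imp_le)
      then show ?thesis using elim(2)[THEN spec, of "g S"] g_sub[of S] by (simp add: C_def)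
    qed
    show ?case
    proof (rule exI[of _ c1], rule exI[of _ g], intro conjI allI impI)
      show "c1 \<in> families_upto n ((real r + 1) * 2 ^ n * real n powr - (real t + 9/10))
          \<rightarrow> families_upto n ((real t + 1 + \<epsilon>) * real (n choose (n div 2)))"
        using c1_le 1(2) by (simp add: families_upto_def C_def)
      show "g \<in> families_upto n ((real r + 1) * ((real t + 2) / (\<epsilon>\<^sup>2 * real n ^ t)) * real (n choose (n div 2)))
          \<rightarrow> families_upto n ((real t + \<epsilon>) * real (n choose (n div 2)))"
        using g_le g_sub by (simp add: families_upto_def C_def)
      fix \<F> assume F: "\<F> \<subseteq> Pow {1..n} \<and> induced_vee_free (r + 1) \<F>"
      define \<H>1 where "\<H>1 = h1 \<F>"
      define \<H>2 where "\<H>2 = h2 (c1 \<F>) \<F>"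
      have sub: "\<H>1 \<subseteq> \<F>" "\<H>2 \<subseteq> \<F>" "\<H>2 \<subseteq> c1 \<F>"
        using 1(1)[of \<F>] 2(1)[of \<F> \<F>] by (auto simp: \<H>1_def \<H>2_def)
      have disj: "\<H>1 \<inter> c1 \<F> = {}" using 1(4)[of \<F>] by (simp add: \<H>1_def)
      \<comment> \<open>The union lies between each of the two fingerprints and \<open>\<F>\<close>,
        so stability applies in both stages: it recovers first the intermediate container, then the
        final one.\<close>
      have "c1 (\<H>1 \<union> \<H>2) = c1 \<F>" using sub by (intro 1(6)) (auto simp: \<H>1_def)
      moreover have "c2 (c1 \<F>) (\<H>1 \<union> \<H>2) = c2 (c1 \<F>) \<F>"
        using sub by (intro 2(6)) (auto simp: \<H>2_def)
      ultimately have g_eq: "g (\<H>1 \<union> \<H>2) = c2 (c1 \<F>) \<F>" by (simp add: g_def)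
      have f_eq: "c1 \<H>1 = c1 \<F>" using sub by (intro 1(6)) (auto simp: \<H>1_def)
      have "real (card \<H>1) * D1 n \<le> (real r + 1) * 2 ^ n"
        using 1(8)[of r \<F>] F by (simp add: \<H>1_def card_Pow)
      then have H1: "real (card \<H>1) \<le> (real r + 1) * 2 ^ n * real n powr - (real t + 9/10)"
        using pos by (simp add: D1_def powr_minus field_simps)
      have "real (card \<H>2) * D2 n \<le> (real r + 1) * real (card (c1 \<F>))"
        using 2(8)[of r \<F> \<F>] F by (simp add: \<H>2_def)
      also have "\<dots> \<le> (real r + 1) * ((real t + 1 + \<epsilon>) * C n)"
        using c1_le by (intro mult_left_mono) auto
      finally have H2: "real (card \<H>2) \<le> (real r + 1) * ((real t + 1 + \<epsilon>) * C n / D2 n)"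
        using pos by (simp add: field_simps)
      \<comment> \<open>The first fingerprint must fit into the slack (1 - \<epsilon>) between t + 1
        + \<epsilon> and t + 2. Since 2^n is at most 2 n^(1/2) times the central coefficient, 2^n
        n^(-9/10) is at most 2 n^(-4/10) times it, hence at most the coefficient itself for large
        n.\<close>
      have "2 ^ n * real n powr - (9/10) \<le> sqrt (2 * (real n + 1)) * C n * real n powr - (9/10)"
        using central_binomial_lower[of n] by (intro mult_right_mono) (auto simp: C_def)
      also have "\<dots> \<le> sqrt (4 * real n) * C n * real n powr - (9/10)"
        using pos elim(3) by (intro mult_right_mono) auto
      also have "\<dots> = 2 * C n * real n powr (1/2 + - (9/10))"
        unfolding powr_add by (simp add: real_sqrt_mult powr_half_sqrt)
      also have "\<dots> \<le> 2 * C n * (1 / 2)"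
        using elim(4) pos by (intro mult_left_mono) auto
      \<comment> \<open>From \<epsilon> \<le> 1/4 one gets \<epsilon>^2 \<le> 1/16 \<le> 1 -
        \<epsilon>.\<close>
      finally have "2 ^ n * real n powr - (9/10) * \<epsilon>\<^sup>2 \<le> C n * (1 - \<epsilon>)"
        using \<epsilon> \<open>0 < \<epsilon>\<close> pos power_mono[OF \<epsilon>, of 2]
        by (intro mult_mono) (auto simp: power2_eq_square)
      moreover have "2 ^ n * real n powr - (real t + 9/10) * D2 n = 2 ^ n * real n powr - (9/10) * \<epsilon>\<^sup>2"
      proof -
        have "real n powr - (real t + 9/10) * real n ^ t = real n powr (- (real t + 9/10) + real t)"
          unfolding powr_add using elim(3) by (simp add: powr_realpow)
        then show ?thesis by (simp add: D2_def)
      qed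
      ultimately have "2 ^ n * real n powr - (real t + 9/10) * D2 n \<le> (1 - \<epsilon>) * C n"
        by (simp only: mult.commute[of "C n"])
      then have small: "2 ^ n * real n powr - (real t + 9/10) \<le> (1 - \<epsilon>) * C n / D2 n"
        by (simp only: pos_le_divide_eq[OF pos(2)])
      have "real (card (\<H>1 \<union> \<H>2)) \<le> real (card \<H>1) + real (card \<H>2)"
        using card_Un_le[of \<H>1 \<H>2] by linarith
      also have "\<dots> \<le> (real r + 1) * (2 ^ n * real n powr - (real t + 9/10) + (real t + 1 + \<epsilon>) * C n / D2 n)"
        using H1 H2 by (simp only: distrib_left mult.assoc)
      also have "\<dots> \<le> (real r + 1) * ((1 - \<epsilon>) * C n / D2 n + (real t + 1 + \<epsilon>) * C n / D2 n)"
        using small by (intro mult_left_mono add_right_mono) auto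
      also have "(1 - \<epsilon>) * C n / D2 n + (real t + 1 + \<epsilon>) * C n / D2 n = (real t + 2) * C n / D2 n"
        by (simp add: algebra_simps flip: add_divide_distrib)
      also have "(real r + 1) * \<dots> = (real r + 1) * ((real t + 2) / (\<epsilon>\<^sup>2 * real n ^ t)) * real (n choose (n div 2))"
        by (simp add: C_def D2_def)
      finally have H12: "real (card (\<H>1 \<union> \<H>2)) \<le> \<dots>" .
      have cover: "\<F> \<subseteq> \<H>1 \<union> \<H>2 \<union> g (\<H>1 \<union> \<H>2)"
        using 1(3)[of \<F>] 2(3)[of \<F> \<F>] F unfolding g_eq unfolding \<H>1_def \<H>2_def by blast
      have disj_g: "(\<H>1 \<union> \<H>2) \<inter> g (\<H>1 \<union> \<H>2) = {}"
        using 2(2,4)[of \<F> \<F>] disj unfolding g_eq unfolding \<H>2_def by blast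
      have H1_mem: "\<H>1 \<in> families_upto n ((real r + 1) * 2 ^ n * real n powr - (real t + 9/10))"
        and H12_mem: "\<H>1 \<union> \<H>2 \<in> families_upto n ((real r + 1) * ((real t + 2) / (\<epsilon>\<^sup>2 * real n ^ t)) * real (n choose (n div 2)))"
        using sub F H1 H12 unfolding families_upto_def by blast+
      have disj12: "\<H>1 \<inter> \<H>2 = {}" using disj sub(3) by blast
      have "\<H>2 \<subseteq> c1 \<H>1" using sub(3) f_eq by simp
      then show "\<exists>\<H>\<^sub>1 \<H>\<^sub>2. \<H>\<^sub>1 \<subseteq> \<F> \<and> \<H>\<^sub>2 \<subseteq> \<F> \<and> \<H>\<^sub>1 \<inter> \<H>\<^sub>2 = {} \<and>
          \<H>\<^sub>1 \<in> families_upto n ((real r + 1) * 2 ^ n * real n powr - (real t + 9/10)) \<and>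
          \<H>\<^sub>1 \<union> \<H>\<^sub>2 \<in> families_upto n ((real r + 1) * ((real t + 2) / (\<epsilon>\<^sup>2 * real n ^ t)) * real (n choose (n div 2))) \<and>
          (\<H>\<^sub>1 \<union> \<H>\<^sub>2) \<inter> g (\<H>\<^sub>1 \<union> \<H>\<^sub>2) = {} \<and>
          \<H>\<^sub>2 \<subseteq> c1 \<H>\<^sub>1 \<and>
          \<F> \<subseteq> \<H>\<^sub>1 \<union> \<H>\<^sub>2 \<union> g (\<H>\<^sub>1 \<union> \<H>\<^sub>2)"
        using sub(1,2) disj12 H1_mem H12_mem disj_g cover
        by - (rule exI[of _ \<H>1], rule exI[of _ \<H>2], intro conjI)
    qed
  qed
  then show ?thesis unfolding eventually_sequentially .
qed

end
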